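(* Let $p\in(2,\infty)$, $q=p/(p-1)$, $\epsilon\in(0,1/2)$, $p_\epsilon=\frac{p-2\epsilon}{1-\epsilon}$, and let $Q:\mathbb R^2\times\mathbb R^2\to[0,\infty)$ be the Nazarov–Treil function associated with $p,\epsilon$. Then for every $\phi\in[-\phi_{p_\epsilon},\phi_{p_\epsilon}]$, every $\xi\in(\mathbb R^2\times\mathbb R^2)\setminus\Upsilon_0$ and every $\omega=(\omega_1,\omega_2)\in\mathbb R^2\times\mathbb R^2$, $$\mathcal R_\phi(Q)[\xi;\omega]\ge2\delta\cos\phi\,|\omega_1||\omega_2|.$$
   Context: For $r>1$, $\phi_r=\arccos|1-2/r|$. Set $\delta=\frac{2q(q-1)\epsilon}{85}$ and $$Q(\zeta,\eta)=|\zeta|^p+|\eta|^q+\delta\begin{cases}|\zeta|^2|\eta|^{2-q},&|\zeta|^p\le|\eta|^q,\\ \frac2p|\zeta|^p+\left(\frac2q-1\right)|\eta|^q,&|\zeta|^p\ge|\eta|^q,\end{cases}\qquad\zeta,\eta\in\mathbb R^2.$$ $\Upsilon_0=\{(\zeta,\eta)\in\mathbb R^2\times\mathbb R^2:\eta=0\text{ or }|\zeta|^p=|\eta|^q\}$; off $\Upsilon_0$ the function $Q$ is $C^2$, with Hessian matrix $\mathcal H(Q)$. Let $$\mathcal O_\phi=\begin{bmatrix}\cos\phi&-\sin\phi\\ \sin\phi&\cos\phi\end{bmatrix},\qquad\mathcal U_\phi=\begin{bmatrix}\mathcal O_\phi&0\\0&\mathcal O_{-\phi}\end{bmatrix}\in\mathbb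 R^{4,4},$$ $\mathcal R_\phi(Q)=\frac12\big(\mathcal U_\phi^T\mathcal H(Q)+\mathcal H(Q)\mathcal U_\phi\big)$ and $\mathcal R_\phi(Q)[\xi;\omega]=\langle\mathcal R_\phi(Q)(\xi)\omega,\omega\rangle_{\mathbb R^4}=\langle\mathcal H(Q)(\xi)\omega,\mathcal U_\phi\omega\rangle_{\mathbb R^4}$. *)

theory Defs
  imports "HOL-Analysis.Analysis"
begin

definition phi_angle :: "real \<Rightarrow> real" where
  "phi_angle r = arccos \<bar>1 - 2 / r\<bar>"

definition conj_exp :: "real \<Rightarrow> real" where
  "conj_exp p = p / (p - 1)"

definition p_eps :: "real \<Rightarrow> real \<Rightarrow> real" where
  "p_eps p \<epsilon> = (p - 2 * \<epsilon>) / (1 - \<epsilon>)"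

definition nt_delta :: "real \<Rightarrow> real \<Rightarrow> real" where
  "nt_delta p \<epsilon> = (let q = conj_exp p in 2 * q * (q - 1) * \<epsilon> / 85)"

(* All exponents used below are positive when p > 2, so "0 powr a = 0" is the usual value.
   The two branches agree where norm \<zeta> powr p = norm \<eta> powr q. *)
definition nazarov_treil :: "real \<Rightarrow> real \<Rightarrow> (real^2) \<times> (real^2) \<Rightarrow> real" where
  "nazarov_treil p \<epsilon> = (\<lambda>(\<zeta>, \<eta>). let q = conj_exp p in
     norm \<zeta> powr p + norm \<eta> powr q + nt_delta p \<epsilon> *
       (if norm \<zeta> powr p \<le> norm \<eta> powr q
        then (norm \<zeta>)\<^sup>2 * norm \<eta> powr (2 - q)
        else 2 / p * norm \<zeta> powr p + (2 / q - 1) * norm \<eta> powr q))"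

definition Upsilon0 :: "real \<Rightarrow> ((real^2) \<times> (real^2)) set" where
  "Upsilon0 p = {(\<zeta>, \<eta>). \<eta> = 0 \<or> norm \<zeta> powr p = norm \<eta> powr conj_exp p}"

(* R^2 x R^2 is identified with R^4, whose coordinates are indexed by the four-element
   type 2 + 2: Inl for the coordinates of \<zeta>, Inr for those of \<eta>. *)
definition to_R4 :: "(real^2) \<times> (real^2) \<Rightarrow> real^(2 + 2)" where
  "to_R4 = (\<lambda>(\<zeta>, \<eta>). \<chi> i. case i of Inl k \<Rightarrow> \<zeta> $ k | Inr k \<Rightarrow> \<eta> $ k)"

definition of_R4 :: "real^(2 + 2) \<Rightarrow> (real^2) \<times> (real^2)" where
  "of_R4 v = ((\<chi> k. v $ Inl k), (\<chi> k. v $ Inr k))"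

definition partial_deriv :: "'n::finite \<Rightarrow> (real^'n \<Rightarrow> real) \<Rightarrow> real^'n \<Rightarrow> real" where
  "partial_deriv i f x = deriv (\<lambda>t. f (x + t *\<^sub>R axis i 1)) 0"

definition hessian :: "(real^'n \<Rightarrow> real) \<Rightarrow> real^'n \<Rightarrow> real^'n^'n" where
  "hessian f x = (\<chi> i j. partial_deriv i (partial_deriv j f) x)"

definition rot :: "real \<Rightarrow> real^2^2" where
  "rot \<phi> = vector [vector [cos \<phi>, - sin \<phi>],
                    vector [sin \<phi>,   cos \<phi>]]"

definition block_diag :: "real^'m^'m \<Rightarrow> real^'n^'n \<Rightarrow> real^('m + 'n)^('m + 'n)" where
  "block_diag A B = (\<chi> i j. case (i, j) of
      (Inl k, Inl l) \<Rightarrow> A $ k $ l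
    | (Inr k, Inr l) \<Rightarrow> B $ k $ l
    | _ \<Rightarrow> 0)"

definition U_mat :: "real \<Rightarrow> real^(2 + 2)^(2 + 2)" where
  "U_mat \<phi> = block_diag (rot \<phi>) (rot (- \<phi>))"

definition R_mat ::
    "real \<Rightarrow> ((real^2) \<times> (real^2) \<Rightarrow> real) \<Rightarrow> (real^2) \<times> (real^2) \<Rightarrow> real^(2 + 2)^(2 + 2)" where
  "R_mat \<phi> Q \<xi> = (let H = hessian (Q \<circ> of_R4) (to_R4 \<xi>) in
     (1 / 2) *\<^sub>R (transpose (U_mat \<phi>) ** H + H ** U_mat \<phi>))"

definition R_form ::
    "real \<Rightarrow> ((real^2) \<times> (real^2) \<Rightarrow> real) \<Rightarrow> (real^2) \<times> (real^2) \<Rightarrow> (real^2) \<times> (real^2) \<Rightarrow> real" where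
  "R_form \<phi> Q \<xi> \<omega> = (R_mat \<phi> Q \<xi> *v to_R4 \<omega>) \<bullet> to_R4 \<omega>"

end

theory Submission
  imports Defs
begin

text \<open>
  Off the exceptional set, \<open>Q\<close> coincides near each point with a function
  \<open>A |\<zeta>|^p + B |\<eta>|^q + C |\<zeta>|^2 |\<eta>|^s\<close>, where \<open>s = 2 - q\<close>: where \<open>|\<zeta>|^p < |\<eta>|^q\<close> the constants
  are \<open>(1, 1, \<delta>)\<close>, and where \<open>|\<zeta>|^p > |\<eta>|^q\<close> they are \<open>(1 + 2\<delta>/p, 1 + \<delta>(2/q - 1), 0)\<close>. One Hessian
  computation therefore serves both regions.

  The Hessian of \<open>|x|^r\<close> is \<open>r |x|^(r-2) (I + (r-2) e e^T)\<close> with \<open>e = x/|x|\<close>. Paired with a rotation by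
  \<open>\<phi>\<close> it gives a quadratic form in the plane whose smaller eigenvalue is
  \<open>r |x|^(r-2) (r cos \<phi> - |r - 2|) / 2\<close> (lemma \<open>duality_deriv_rot_ge\<close>). For the conjugate exponents \<open>p\<close>
  and \<open>q\<close> this number has the same sign, that of \<open>cos \<phi> - (1 - 2/p)\<close>. Taking the angle at most
  \<open>\<phi>_r\<close> with \<open>r = p_\<epsilon> > p\<close> instead of \<open>r = p\<close> makes it strictly positive, with
  \<open>p cos \<phi> - (p - 2) \<ge> 2\<epsilon> cos \<phi>\<close>; the constant \<open>\<delta>\<close> is so small that
  \<open>q (q cos \<phi> - (2 - q)) \<ge> 85 \<delta> cos \<phi>\<close> (lemma \<open>ellipticity_gap\<close>).

  Write \<open>u = |\<zeta>|\<close>, \<open>v = |\<eta>|\<close>, \<open>X = |\<omega>_1|\<close>, \<open>Y = |\<omega>_2|\<close>.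
  Where \<open>u^p > v^q\<close> the form is at least \<open>\<delta> cos \<phi> (u^(p-2) X^2 + v^(q-2) Y^2)\<close>, and
  \<open>u^(p-2) v^(q-2) \<ge> 1\<close>, so the inequality of the arithmetic and geometric means gives the claim.
  Where \<open>u^p < v^q\<close> the \<open>\<zeta>\<close>-block of the mixed term contributes \<open>2 \<delta> cos \<phi> v^(2-q) X^2\<close>, and
  the \<open>\<eta>\<close>-block of \<open>|\<eta>|^q\<close> contributes \<open>85/2 \<delta> cos \<phi> v^(q-2) Y^2\<close>. What remains of the mixed term
  may be negative, but \<open>u \<le> v^(q-1)\<close> and \<open>2 - q \<le> q cos \<phi>\<close> bound it below by
  \<open>- 2 \<delta> cos \<phi> v^(q-2) Y^2 - 8 \<delta> cos \<phi> X Y\<close>. Since \<open>v^(2-q) v^(q-2) = 1\<close>, completing the square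
  leaves \<open>2 \<delta> cos \<phi> X Y\<close> (lemma \<open>subcritical_form_ge\<close>).
\<close>

section \<open>Derivatives of powers of the norm\<close>

lemma has_derivative_zero_of_norm_powr:
  fixes f :: "'a::real_normed_vector \<Rightarrow> 'b::real_normed_vector"
  assumes "1 < a" and "\<And>h. norm (f h) = norm h powr a"
  shows "(f has_derivative (\<lambda>h. 0)) (at 0)"
proof -
  have f0: "f 0 = 0" using assms(2)[of 0] by simp
  have "((\<lambda>h::'a. norm h powr (a - 1)) \<longlongrightarrow> 0) (at 0)"
  proof -
    have "((\<lambda>h::'a. norm h powr (a - 1)) \<longlongrightarrow> norm (0::'a) powr (a - 1)) (at 0)"
      using assms(1) by (intro tendsto_powr' tendsto_norm tendsto_ident_at tendsto_const) auto
    then show ?thesis by simp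
  qed
  moreover have "norm (f h) / norm h = norm h powr (a - 1)" if "h \<noteq> 0" for h
    using that by (simp add: assms(2) powr_diff)
  ultimately have "((\<lambda>h. norm (f h) / norm h) \<longlongrightarrow> 0) (at 0)"
    by (subst tendsto_cong[where g = "\<lambda>h. norm h powr (a - 1)"]) (auto simp: eventually_at_filter)
  then show ?thesis by (simp add: has_derivative_at f0)
qed

lemma has_derivative_norm_powr_nonzero:
  fixes x :: "'a::real_inner"
  assumes "x \<noteq> 0"
  shows "((\<lambda>y. norm y powr r) has_derivative
           (\<lambda>h. (r * norm x powr (r - 2)) *\<^sub>R x \<bullet> h)) (at x)"
proof -
  have "((\<lambda>t. t powr r) has_field_derivative r * norm x powr (r - 1)) (at (norm x))"
    using assms by (intro has_real_derivative_powr) simp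
  from DERIV_compose_FDERIV[OF this has_derivative_norm[OF assms]]
  have "((\<lambda>y. norm y powr r) has_derivative (\<lambda>h. (sgn x \<bullet> h) * (r * norm x powr (r - 1)))) (at x)"
    by (simp add: inner_commute)
  moreover have "norm x powr (r - 1) = norm x powr (r - 2) * norm x"
    using assms powr_add[of "norm x" "r - 2" 1] by simp
  then have "(\<lambda>h. (sgn x \<bullet> h) * (r * norm x powr (r - 1))) = (\<lambda>h. (r * norm x powr (r - 2)) *\<^sub>R x \<bullet> h)"
    using assms by (simp add: fun_eq_iff sgn_div_norm)
  ultimately show ?thesis by simp
qed

text \<open>
  The origin is admitted as soon as the power is differentiable there, because \<open>\<zeta>\<close> may vanish off the
  exceptional set.
\<close>

lemma has_derivative_norm_powr:
  fixes x :: "'a::real_inner"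
  assumes "x \<noteq> 0 \<or> 1 < r"
  shows "((\<lambda>y. norm y powr r) has_derivative
           (\<lambda>h. (r * norm x powr (r - 2)) *\<^sub>R x \<bullet> h)) (at x)"
proof (cases "x = 0")
  case True
  have "((\<lambda>y::'a. norm y powr r) has_derivative (\<lambda>h. 0)) (at 0)"
    using assms True by (intro has_derivative_zero_of_norm_powr[of r]) auto
  then show ?thesis using True by simp
qed (rule has_derivative_norm_powr_nonzero)

text \<open>
  The derivative at \<open>x\<close> of the duality map \<open>y \<mapsto> |y|^(r-2) y\<close>; multiplied by \<open>r\<close>, it is the Hessian of
  \<open>|y|^r\<close>. Since \<open>0 powr a = 0\<close>, the formula gives \<open>0\<close> at \<open>x = 0\<close>, which is the right value for \<open>r > 2\<close>.
\<close>

definition duality_deriv :: "real \<Rightarrow> 'a::real_inner \<Rightarrow> 'a \<Rightarrow> 'a" where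
  "duality_deriv r x h = norm x powr (r - 2) *\<^sub>R h + ((r - 2) * norm x powr (r - 4) * (x \<bullet> h)) *\<^sub>R x"

lemma has_derivative_duality:
  fixes x :: "'a::real_inner"
  assumes "x \<noteq> 0 \<or> 2 < r"
  shows "((\<lambda>y. norm y powr (r - 2) *\<^sub>R y) has_derivative duality_deriv r x) (at x)"
proof (cases "x = 0")
  case True
  have n: "norm (norm h powr (r - 2) *\<^sub>R h) = norm h powr (r - 1)" for h :: 'a
    using powr_add[of "norm h" "r - 2" 1] by (cases "h = 0") auto
  have "((\<lambda>y::'a. norm y powr (r - 2) *\<^sub>R y) has_derivative (\<lambda>h. 0)) (at 0)"
    using assms True by (intro has_derivative_zero_of_norm_powr[OF _ n]) auto
  moreover have "duality_deriv r x = (\<lambda>h. 0)"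
    using assms True by (auto simp: duality_deriv_def)
  ultimately show ?thesis using True by simp
next
  case False
  show ?thesis
    apply (rule has_derivative_eq_rhs)
    apply (rule has_derivative_scaleR[OF has_derivative_norm_powr_nonzero[OF False] has_derivative_ident])
    apply (simp add: duality_deriv_def fun_eq_iff)
    done
qed

section \<open>The quadratic form through the derivative of the gradient\<close>

lemma partial_deriv_eq:
  assumes "(f has_derivative f') (at x)"
  shows "partial_deriv i f x = f' (axis i 1)"
proof -
  have "(f has_derivative f') (at (x + 0 *\<^sub>R axis i 1))" using assms by simp
  moreover have "((\<lambda>t::real. x + t *\<^sub>R axis i 1) has_derivative (\<lambda>t. t *\<^sub>R axis i 1)) (at 0)"
    by (auto intro!: derivative_eq_intros)
  ultimately have "((\<lambda>t::real. f (x + t *\<^sub>R axis i 1)) has_derivative (\<lambda>t. f' (t *\<^sub>R axis i 1))) (at 0)"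
    using has_derivative_compose[of "\<lambda>t::real. x + t *\<^sub>R axis i 1" "\<lambda>t. t *\<^sub>R axis i 1" 0 UNIV f f'] by simp
  moreover have "f' (t *\<^sub>R axis i 1) = f' (axis i 1) * t" for t
    using has_derivative_linear[OF assms] by (simp add: linear_scale)
  ultimately have "((\<lambda>t::real. f (x + t *\<^sub>R axis i 1)) has_field_derivative f' (axis i 1)) (at 0)"
    by (simp add: has_field_derivative_def)
  then show ?thesis unfolding partial_deriv_def by (rule DERIV_imp_deriv)
qed

text \<open>
  The inner partial derivative has to be known on a neighbourhood of \<open>x\<close> before the outer one can be
  taken, hence the open set \<open>S\<close>.
\<close>

lemma hessian_eq_gradient_derivative:
  fixes f :: "real^'n \<Rightarrow> real"
  assumes "open S" and "x \<in> S"
    and f: "\<And>y. y \<in> S \<Longrightarrow> (f has_derivative (\<lambda>h. G y \<bullet> h)) (at y)"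
    and G: "(G has_derivative G') (at x)"
  shows "hessian f x $ i $ j = G' (axis i 1) $ j"
proof -
  have "((\<lambda>y. G y $ j) has_derivative (\<lambda>h. G' h $ j)) (at x)"
    by (rule bounded_linear.has_derivative[OF bounded_linear_vec_nth G])
  moreover have "G y $ j = partial_deriv j f y" if "y \<in> S" for y
    using partial_deriv_eq[OF f[OF that]] by (simp add: inner_axis)
  ultimately have "(partial_deriv j f has_derivative (\<lambda>h. G' h $ j)) (at x)"
    by (rule has_derivative_transform_within_open[OF _ assms(1,2)])
  from partial_deriv_eq[OF this] show ?thesis by (simp add: hessian_def)
qed

text \<open>
  In the Hessian as defined by iterated partial derivatives the row index is that of the outer
  derivative, so the derivative of the gradient appears as the transpose. Moving it to the other factor
  of the inner product avoids any appeal to the symmetry of second derivatives.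
\<close>

lemma inner_matrix_vector_eq:
  fixes H :: "real^'n^'n"
  assumes "linear L" and "\<And>i j. H $ i $ j = L (axis i 1) $ j"
  shows "(H *v a) \<bullet> b = a \<bullet> L b"
proof -
  have "transpose H = matrix L"
    by (simp add: vec_eq_iff transpose_def matrix_def assms(2))
  then have "transpose H *v b = L b" using assms(1) by (simp add: matrix_works linear_matrix_vector_mul_eq)
  then show ?thesis by (metis dot_lmul_matrix vector_transpose_matrix transpose_matrix_vector)
qed

lemma linear_of_R4: "linear of_R4"
  by (auto simp: of_R4_def linear_iff vec_eq_iff)

lemma linear_to_R4: "linear to_R4"
  by (auto simp: to_R4_def linear_iff vec_eq_iff split: sum.split)

lemma of_R4_to_R4 [simp]: "of_R4 (to_R4 z) = z"
  by (cases z) (simp add: to_R4_def of_R4_def vec_eq_iff)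

lemma sum_UNIV_Plus: "(\<Sum>i\<in>(UNIV::('a::finite+'b::finite) set). f i) = (\<Sum>i\<in>UNIV. f (Inl i)) + (\<Sum>i\<in>UNIV. f (Inr i))"
  by (simp flip: UNIV_Plus_UNIV add: sum.Plus)

lemma inner_to_R4: "to_R4 y \<bullet> v = y \<bullet> of_R4 v"
  by (cases y) (simp add: to_R4_def of_R4_def inner_vec_def sum_UNIV_Plus)

lemma U_mat_to_R4: "U_mat \<phi> *v to_R4 (a, b) = to_R4 (rot \<phi> *v a, rot (- \<phi>) *v b)"
  by (auto simp: U_mat_def block_diag_def to_R4_def vec_eq_iff matrix_vector_mult_def sum_UNIV_Plus split: sum.split)

text \<open>
  The two summands come from the two terms of the symmetrisation; the identification of the product
  space with \<open>\<real>^4\<close> is an isometry and disappears.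
\<close>

lemma R_form_eq_gradient_derivative:
  fixes a b :: "real^2" and \<phi> :: real
  defines "\<omega>' \<equiv> (rot \<phi> *v a, rot (- \<phi>) *v b)"
  assumes S: "open S" "\<xi> \<in> S"
    and Q: "\<And>z. z \<in> S \<Longrightarrow> (Q has_derivative (\<lambda>h. g z \<bullet> h)) (at z)"
    and g: "(g has_derivative g') (at \<xi>)"
  shows "R_form \<phi> Q \<xi> (a, b) = ((a, b) \<bullet> g' \<omega>' + \<omega>' \<bullet> g' (a, b)) / 2"
proof -
  have bl: "bounded_linear of_R4" "bounded_linear to_R4"
    using linear_of_R4 linear_to_R4 by (simp_all add: linear_conv_bounded_linear)
  have D: "(of_R4 has_derivative of_R4) (at v)" for v
    using bl(1) by (rule bounded_linear_imp_has_derivative)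
  define H where "H = hessian (Q \<circ> of_R4) (to_R4 \<xi>)"
  define L where "L = (\<lambda>v. to_R4 (g' (of_R4 v)))"
  have 1: "(Q \<circ> of_R4 has_derivative (\<lambda>h. to_R4 (g (of_R4 v)) \<bullet> h)) (at v)"
    if "v \<in> of_R4 -` S" for v
    using has_derivative_compose[OF D[of v], of Q] Q[of "of_R4 v"] that
    by (simp add: o_def inner_to_R4)
  have 2: "open (of_R4 -` S)"
    using S(1) linear_continuous_on[OF bl(1), of UNIV] by (intro open_vimage)
  have 3: "((\<lambda>v. to_R4 (g (of_R4 v))) has_derivative L) (at (to_R4 \<xi>))"
    unfolding L_def using has_derivative_compose[OF D[of "to_R4 \<xi>"], of g g'] g
    by (intro bounded_linear.has_derivative[OF bl(2)]) simp
  have "H $ i $ j = L (axis i 1) $ j" for i j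
    unfolding H_def by (rule hessian_eq_gradient_derivative[OF 2 _ 1 3]) (use S in simp_all)
  moreover have "linear L"
    unfolding L_def using linear_compose[OF linear_compose[OF linear_of_R4 has_derivative_linear[OF g]] linear_to_R4]
    by (simp add: o_def)
  ultimately have HL: "(H *v v) \<bullet> w = v \<bullet> L w" for v w
    by (intro inner_matrix_vector_eq)
  define W where "W = to_R4 (a, b)"
  have U: "U_mat \<phi> *v W = to_R4 \<omega>'"
    by (simp add: W_def \<omega>'_def U_mat_to_R4)
  have "R_form \<phi> Q \<xi> (a, b) = ((H *v W) \<bullet> (U_mat \<phi> *v W) + (H *v (U_mat \<phi> *v W)) \<bullet> W) / 2"
    unfolding R_form_def R_mat_def Let_def H_def[symmetric] W_def[symmetric]
    by (simp add: scaleR_matrix_vector_assoc[symmetric] matrix_vector_mult_add_rdistrib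
        matrix_vector_mul_assoc[symmetric] inner_add_left dot_lmul_matrix[symmetric] inner_commute[of "transpose _ *v _"])
  also have "\<dots> = (W \<bullet> L (to_R4 \<omega>') + to_R4 \<omega>' \<bullet> L W) / 2" by (simp add: U HL)
  also have "\<dots> = ((a, b) \<bullet> g' \<omega>' + \<omega>' \<bullet> g' (a, b)) / 2"
    by (simp add: L_def W_def inner_to_R4)
  finally show ?thesis .
qed

section \<open>Rotations and the Hessian of a power of the norm\<close>

lemma rot_nth:
  "(rot \<phi> *v w) $ 1 = cos \<phi> * w $ 1 - sin \<phi> * w $ 2"
  "(rot \<phi> *v w) $ 2 = sin \<phi> * w $ 1 + cos \<phi> * w $ 2"
  by (simp_all add: rot_def matrix_vector_mult_def sum_2)

lemma inner_rot: "w \<bullet> (rot \<phi> *v w) = cos \<phi> * (norm w)\<^sup>2"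
  by (simp add: inner_vec_def sum_2 rot_nth power2_norm_eq_inner algebra_simps)

lemma norm_rot [simp]: "norm (rot \<phi> *v w) = norm w"
proof -
  have "(norm (rot \<phi> *v w))\<^sup>2 = ((cos \<phi>)\<^sup>2 + (sin \<phi>)\<^sup>2) * (norm w)\<^sup>2"
    unfolding power2_norm_eq_inner inner_vec_def sum_2 rot_nth inner_real_def
    by (simp add: power2_eq_square algebra_simps del: sin_cos_squared_add sin_cos_squared_add2 sin_cos_squared_add3)
  then show ?thesis by simp
qed

text \<open>
  If \<open>\<theta>\<close> is the angle from \<open>w\<close> to \<open>x\<close>, the left-hand side is \<open>|x|^2 |w|^2 |cos (2\<theta> - \<phi>)|\<close> by the
  product formula for cosines. In coordinates, with \<open>a = |x| |w| cos \<theta>\<close> and \<open>b = |x| |w| sin \<theta>\<close>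
  up to sign, this is the Cauchy-Schwarz inequality for \<open>(a^2 - b^2, 2ab)\<close> and \<open>(cos \<phi>, sin \<phi>)\<close>.
\<close>

lemma abs_two_inner_rot_le:
  "\<bar>2 * (x \<bullet> w) * (x \<bullet> (rot \<phi> *v w)) - cos \<phi> * ((norm x)\<^sup>2 * (norm w)\<^sup>2)\<bar> \<le> (norm x)\<^sup>2 * (norm w)\<^sup>2"
proof -
  define a where "a = x \<bullet> w"
  define b where "b = x $ 2 * w $ 1 - x $ 1 * w $ 2"
  have ab: "(norm x)\<^sup>2 * (norm w)\<^sup>2 = a\<^sup>2 + b\<^sup>2"
    unfolding power2_norm_eq_inner a_def b_def inner_vec_def sum_2 inner_real_def
    by (simp add: power2_eq_square algebra_simps)
  have xw: "x \<bullet> (rot \<phi> *v w) = a * cos \<phi> + b * sin \<phi>"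
    by (simp add: a_def b_def inner_vec_def sum_2 rot_nth algebra_simps)
  have "((a\<^sup>2 - b\<^sup>2) * cos \<phi> + 2 * a * b * sin \<phi>)\<^sup>2 + ((a\<^sup>2 - b\<^sup>2) * sin \<phi> - 2 * a * b * cos \<phi>)\<^sup>2
      = (a\<^sup>2 + b\<^sup>2)\<^sup>2 * ((cos \<phi>)\<^sup>2 + (sin \<phi>)\<^sup>2)"
    by (simp add: power2_eq_square algebra_simps del: sin_cos_squared_add sin_cos_squared_add2 sin_cos_squared_add3)
  then have "((a\<^sup>2 - b\<^sup>2) * cos \<phi> + 2 * a * b * sin \<phi>)\<^sup>2 \<le> (a\<^sup>2 + b\<^sup>2)\<^sup>2"
    using zero_le_power2[of "(a\<^sup>2 - b\<^sup>2) * sin \<phi> - 2 * a * b * cos \<phi>"]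
    unfolding sin_cos_squared_add2 by linarith
  then have "\<bar>(a\<^sup>2 - b\<^sup>2) * cos \<phi> + 2 * a * b * sin \<phi>\<bar> \<le> \<bar>a\<^sup>2 + b\<^sup>2\<bar>"
    by (simp only: abs_le_square_iff)
  moreover have "2 * a * (a * cos \<phi> + b * sin \<phi>) - cos \<phi> * (a\<^sup>2 + b\<^sup>2) = (a\<^sup>2 - b\<^sup>2) * cos \<phi> + 2 * a * b * sin \<phi>"
    by (simp add: power2_eq_square algebra_simps)
  ultimately show ?thesis unfolding ab xw a_def[symmetric] by simp
qed

text \<open>
  Up to the factor \<open>|x|^(r-2)\<close>, the identity part of the Hessian contributes \<open>cos \<phi> |w|^2\<close>, and the
  rank-one part contributes \<open>(r - 2)/2 (cos \<phi> |w|^2 + t)\<close> with \<open>|t| \<le> |w|^2\<close> by the preceding bound.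
  The worst case is \<open>t = - sgn (r - 2) |w|^2\<close>, which some \<open>w\<close> attains: the constant is the smaller
  eigenvalue of the form.
\<close>

lemma duality_deriv_rot_ge:
  "norm x powr (r - 2) * ((r * cos \<phi> - \<bar>r - 2\<bar>) / 2) * (norm w)\<^sup>2
     \<le> (w \<bullet> duality_deriv r x (rot \<phi> *v w) + (rot \<phi> *v w) \<bullet> duality_deriv r x w) / 2"
proof (cases "x = 0")
  case True
  then show ?thesis by (simp add: duality_deriv_def)
next
  case False
  define P where "P = 2 * (x \<bullet> w) * (x \<bullet> (rot \<phi> *v w)) - cos \<phi> * ((norm x)\<^sup>2 * (norm w)\<^sup>2)"
  define M where "M = norm x powr (r - 4)"
  have M: "norm x powr (r - 2) = M * (norm x)\<^sup>2" "0 \<le> M"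
    using powr_add[of "norm x" "r - 4" 2] False by (simp_all add: M_def)
  have "\<bar>r - 2\<bar> * \<bar>P\<bar> \<le> \<bar>r - 2\<bar> * ((norm x)\<^sup>2 * (norm w)\<^sup>2)"
    unfolding P_def by (intro mult_left_mono abs_two_inner_rot_le) simp
  then have "- \<bar>r - 2\<bar> * ((norm x)\<^sup>2 * (norm w)\<^sup>2) \<le> (r - 2) * P"
    using abs_ge_minus_self[of "(r - 2) * P"] unfolding abs_mult mult_minus_left by linarith
  then have le: "M * (- \<bar>r - 2\<bar> * ((norm x)\<^sup>2 * (norm w)\<^sup>2)) \<le> M * ((r - 2) * P)"
    using M(2) by (rule mult_left_mono)
  have eq: "(w \<bullet> duality_deriv r x (rot \<phi> *v w) + (rot \<phi> *v w) \<bullet> duality_deriv r x w) / 2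
      = M * (norm x)\<^sup>2 * (cos \<phi> * (norm w)\<^sup>2) + (r - 2) * M * (x \<bullet> w) * (x \<bullet> (rot \<phi> *v w))"
    unfolding duality_deriv_def M(1) M_def[symmetric] inner_add_right inner_scaleR_right
      inner_commute[of _ x] inner_commute[of "rot \<phi> *v w" w] inner_rot
    by (simp add: field_simps)
  show ?thesis using le unfolding eq M(1) P_def by (simp add: field_simps)
qed

section \<open>Lower bound for the local model\<close>

text \<open>
  The two pure powers and the \<open>\<eta>\<close>-block of the mixed term are instances of \<open>duality_deriv_rot_ge\<close>, with
  \<open>r = p, q, s\<close>; the \<open>\<zeta>\<close>-block of the mixed term is a multiple of the identity. For the off-diagonal
  blocks the Cauchy-Schwarz inequality is enough, as rotations preserve norms. The variables are
  rotated by \<open>\<phi>\<close> and by \<open>- \<phi>\<close>, but only the cosine survives in the bounds.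
\<close>

lemma R_form_power_model_ge:
  fixes a b :: "real^2"
  assumes "2 < p" "1 < q" "q < 2" "0 \<le> s" "s < 2" "0 \<le> A" "0 \<le> B" "0 \<le> C" "\<eta> \<noteq> 0"
    and S: "open S" "(\<zeta>, \<eta>) \<in> S" "\<And>z. z \<in> S \<Longrightarrow> snd z \<noteq> 0"
    and Q: "\<And>z. z \<in> S \<Longrightarrow> Q z = A * norm (fst z) powr p + B * norm (snd z) powr q
                + C * ((norm (fst z))\<^sup>2 * norm (snd z) powr s)"
  shows "R_form \<phi> Q (\<zeta>, \<eta>) (a, b) \<ge>
      A * p * (norm \<zeta> powr (p - 2) * ((p * cos \<phi> - (p - 2)) / 2) * (norm a)\<^sup>2)
    + B * q * (norm \<eta> powr (q - 2) * ((q * cos \<phi> - (2 - q)) / 2) * (norm b)\<^sup>2)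
    + C * (2 * norm \<eta> powr s * cos \<phi> * (norm a)\<^sup>2
           + s * (norm \<zeta>)\<^sup>2 * (norm \<eta> powr (s - 2) * ((s * cos \<phi> - (2 - s)) / 2) * (norm b)\<^sup>2)
           - 4 * s * norm \<zeta> * norm \<eta> powr (s - 1) * norm a * norm b)"
proof -
  define g :: "(real^2) \<times> (real^2) \<Rightarrow> (real^2) \<times> (real^2)" where
    "g = (\<lambda>z. ((A * p) *\<^sub>R (norm (fst z) powr (p - 2) *\<^sub>R fst z) + (2 * C) *\<^sub>R (norm (snd z) powr s *\<^sub>R fst z),
               (B * q) *\<^sub>R (norm (snd z) powr (q - 2) *\<^sub>R snd z)
               + (C * s) *\<^sub>R ((fst z \<bullet> fst z) *\<^sub>R (norm (snd z) powr (s - 2) *\<^sub>R snd z))))"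
  define g' :: "(real^2) \<times> (real^2) \<Rightarrow> (real^2) \<times> (real^2)" where
    "g' = (\<lambda>h. ((A * p) *\<^sub>R duality_deriv p \<zeta> (fst h)
                 + (2 * C) *\<^sub>R (norm \<eta> powr s *\<^sub>R fst h + ((s * norm \<eta> powr (s - 2)) *\<^sub>R \<eta> \<bullet> snd h) *\<^sub>R \<zeta>),
               (B * q) *\<^sub>R duality_deriv q \<eta> (snd h)
                 + (C * s) *\<^sub>R ((\<zeta> \<bullet> \<zeta>) *\<^sub>R duality_deriv s \<eta> (snd h)
                     + (\<zeta> \<bullet> fst h + fst h \<bullet> \<zeta>) *\<^sub>R (norm \<eta> powr (s - 2) *\<^sub>R \<eta>))))"
  have grad: "(Q has_derivative (\<lambda>h. g z \<bullet> h)) (at z)" if z: "z \<in> S" for z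
  proof -
    have nz: "fst z \<noteq> 0 \<or> 1 < p" "snd z \<noteq> 0 \<or> 1 < q" "snd z \<noteq> 0 \<or> 1 < s"
      using assms(1) S(3)[OF z] by auto
    note I1 = has_derivative_fst[OF has_derivative_ident, of "at z"]
    note I2 = has_derivative_snd[OF has_derivative_ident, of "at z"]
    note D1 = has_derivative_compose[OF I1 has_derivative_norm_powr[OF nz(1)]]
    note D2 = has_derivative_compose[OF I2 has_derivative_norm_powr[OF nz(2)]]
    note D3 = has_derivative_compose[OF I2 has_derivative_norm_powr[OF nz(3)]]
    note D4 = has_derivative_inner[OF I1 I1]
    have "((\<lambda>z. A * norm (fst z) powr p + B * norm (snd z) powr q
                + C * ((fst z \<bullet> fst z) * norm (snd z) powr s)) has_derivative (\<lambda>h. g z \<bullet> h)) (at z)"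
      apply (rule has_derivative_eq_rhs)
       apply (rule has_derivative_add has_derivative_mult_right has_derivative_mult D1 D2 D3 D4)+
      by (auto simp: fun_eq_iff g_def inner_prod_def inner_add_left inner_commute algebra_simps)
    then show ?thesis
      by (rule has_derivative_transform_within_open[OF _ S(1) z]) (simp add: Q power2_norm_eq_inner)
  qed
  have grad': "(g has_derivative g') (at (\<zeta>, \<eta>))"
  proof -
    let ?F = "at (\<zeta>, \<eta>)"
    have nz: "\<zeta> \<noteq> 0 \<or> 2 < p" "\<eta> \<noteq> 0 \<or> 2 < q" "\<eta> \<noteq> 0 \<or> 2 < s" "\<eta> \<noteq> 0 \<or> 1 < s" using assms(1,9) by auto
    note I1 = has_derivative_fst[OF has_derivative_ident, of ?F]
    note I2 = has_derivative_snd[OF has_derivative_ident, of ?F]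
    note D1 = has_derivative_compose[OF I1, simplified, OF has_derivative_duality[OF nz(1)]]
    note D2 = has_derivative_compose[OF I2, simplified, OF has_derivative_duality[OF nz(2)]]
    note D3 = has_derivative_compose[OF I2, simplified, OF has_derivative_duality[OF nz(3)]]
    note D4 = has_derivative_compose[OF I2, simplified, OF has_derivative_norm_powr[OF nz(4)]]
    show ?thesis unfolding g_def
      apply (rule has_derivative_eq_rhs)
       apply (rule has_derivative_Pair has_derivative_add has_derivative_scaleR_right
          has_derivative_scaleR[OF D4 I1] has_derivative_scaleR[OF has_derivative_inner[OF I1 I1] D3] D1 D2)+
      by (simp add: fun_eq_iff g'_def)
  qed
  define a' where "a' = rot \<phi> *v a"
  define b' where "b' = rot (- \<phi>) *v b"
  have R: "R_form \<phi> Q (\<zeta>, \<eta>) (a, b) = ((a, b) \<bullet> g' (a', b') + (a', b') \<bullet> g' (a, b)) / 2"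
    unfolding a'_def b'_def by (rule R_form_eq_gradient_derivative[OF S(1,2) grad grad'])
  define X where "X = (a \<bullet> \<zeta>) * (b' \<bullet> \<eta>) + (a' \<bullet> \<zeta>) * (b \<bullet> \<eta>)"
  define F where "F = (\<lambda>r x w w'. (w \<bullet> duality_deriv r x w' + w' \<bullet> duality_deriv r x (w :: real^2)) / 2)"
  have R': "R_form \<phi> Q (\<zeta>, \<eta>) (a, b) = A * p * F p \<zeta> a a' + B * q * F q \<eta> b b'
      + C * (2 * norm \<eta> powr s * cos \<phi> * (norm a)\<^sup>2 + s * (norm \<zeta>)\<^sup>2 * F s \<eta> b b'
             + 2 * s * norm \<eta> powr (s - 2) * X)"
  proof -
    have "R_form \<phi> Q (\<zeta>, \<eta>) (a, b) = A * p * F p \<zeta> a a' + B * q * F q \<eta> b b'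
      + C * (2 * norm \<eta> powr s * (a \<bullet> a') + s * (norm \<zeta>)\<^sup>2 * F s \<eta> b b'
             + 2 * s * norm \<eta> powr (s - 2) * X)"
      unfolding R X_def F_def
      by (simp add: g'_def inner_add_right inner_add_left power2_norm_eq_inner inner_commute field_simps)
    also have "a \<bullet> a' = cos \<phi> * (norm a)\<^sup>2" by (simp add: a'_def inner_rot)
    finally show ?thesis by (simp only: mult.assoc)
  qed
  have X: "- (2 * norm \<zeta> * norm \<eta> * norm a * norm b) \<le> X"
  proof -
    have "\<bar>(a \<bullet> \<zeta>) * (b' \<bullet> \<eta>)\<bar> \<le> (norm a * norm \<zeta>) * (norm b' * norm \<eta>)"
         "\<bar>(a' \<bullet> \<zeta>) * (b \<bullet> \<eta>)\<bar> \<le> (norm a' * norm \<zeta>) * (norm b * norm \<eta>)"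
      unfolding abs_mult by (intro mult_mono Cauchy_Schwarz_ineq2; simp)+
    then show ?thesis unfolding X_def by (simp add: a'_def b'_def mult_ac)
  qed
  have "norm \<eta> powr (s - 1) = norm \<eta> powr (s - 2) * norm \<eta>"
    using powr_add[of "norm \<eta>" "s - 2" 1] assms(9) by simp
  then have "- (4 * s * norm \<zeta> * norm \<eta> powr (s - 1) * norm a * norm b)
      = 2 * s * norm \<eta> powr (s - 2) * - (2 * norm \<zeta> * norm \<eta> * norm a * norm b)"
    by simp
  also have "\<dots> \<le> 2 * s * norm \<eta> powr (s - 2) * X"
    using assms(4) by (intro mult_left_mono[OF X]) simp
  finally have cross: "- (4 * s * norm \<zeta> * norm \<eta> powr (s - 1) * norm a * norm b)
      \<le> 2 * s * norm \<eta> powr (s - 2) * X" .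
  have Fa: "norm \<zeta> powr (p - 2) * ((p * cos \<phi> - (p - 2)) / 2) * (norm a)\<^sup>2 \<le> F p \<zeta> a a'"
    using duality_deriv_rot_ge[of \<zeta> p \<phi> a] assms(1) by (simp add: a'_def F_def)
  have Fb: "norm \<eta> powr (r - 2) * ((r * cos \<phi> - (2 - r)) / 2) * (norm b)\<^sup>2 \<le> F r \<eta> b b'" if "r < 2" for r
    using duality_deriv_rot_ge[of \<eta> r "- \<phi>" b] that by (simp add: b'_def F_def)
  have 1: "0 \<le> A * p" "0 \<le> B * q" "0 \<le> s * (norm \<zeta>)\<^sup>2" using assms by simp_all
  note 2 = mult_left_mono[OF Fb[OF \<open>s < 2\<close>] 1(3)]
  have "2 * norm \<eta> powr s * cos \<phi> * (norm a)\<^sup>2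
           + s * (norm \<zeta>)\<^sup>2 * (norm \<eta> powr (s - 2) * ((s * cos \<phi> - (2 - s)) / 2) * (norm b)\<^sup>2)
           - 4 * s * norm \<zeta> * norm \<eta> powr (s - 1) * norm a * norm b
       \<le> 2 * norm \<eta> powr s * cos \<phi> * (norm a)\<^sup>2 + s * (norm \<zeta>)\<^sup>2 * F s \<eta> b b'
             + 2 * s * norm \<eta> powr (s - 2) * X"
    using 2 cross by linarith
  from mult_left_mono[OF this \<open>0 \<le> C\<close>] show ?thesis
    unfolding R' using mult_left_mono[OF Fa 1(1)] mult_left_mono[OF Fb[OF \<open>q < 2\<close>] 1(2)]
    by linarith
qed

section \<open>Arithmetic of the two regions\<close>

lemma weighted_square_sum_ge:
  fixes U V x y :: real
  assumes "0 < U" "1 \<le> U * V"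
  shows "2 * x * y \<le> U * x\<^sup>2 + V * y\<^sup>2"
proof -
  have "1 / U \<le> V" using assms by (simp add: field_simps)
  then have "(1 / U) * y\<^sup>2 \<le> V * y\<^sup>2" by (intro mult_right_mono) auto
  moreover have "0 \<le> (U * x - y)\<^sup>2 / U" using assms by simp
  moreover have "(U * x - y)\<^sup>2 / U = U * x\<^sup>2 + (1 / U) * y\<^sup>2 - 2 * x * y"
    using assms(1) by (simp add: field_simps power2_eq_square)
  ultimately show ?thesis by linarith
qed

text \<open>
  The part of the lower bound for the region \<open>|\<zeta>|^p < |\<eta>|^q\<close> that suffices there. In the application
  \<open>K = v^(2-q)\<close>, \<open>m = v^(q-2)\<close>, \<open>W = u v^(1-q)\<close> and \<open>N = u^2 v^(-q)\<close> for \<open>u = |\<zeta>|\<close> and \<open>v = |\<eta>|\<close>, so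
  the hypotheses on \<open>W\<close> and \<open>N\<close> say that \<open>u \<le> v^(q-1)\<close>. In units of \<open>\<delta> c\<close>, the gap gives
  \<open>85/2 m Y^2\<close>, of which the negative \<open>\<eta>\<close>-block takes at most \<open>2 m Y^2\<close>, since
  \<open>q (2 - q) \<le> q^2 c \<le> 4 c\<close>. The off-diagonal blocks cost at most \<open>8 X Y\<close>, since
  \<open>2 - q \<le> q c \<le> 2 c\<close>. So it remains to see that \<open>2 K X^2 + 81/2 m Y^2 \<ge> 10 X Y\<close>.
\<close>

lemma subcritical_form_ge:
  fixes q c \<delta> K m W N X Y :: real
  assumes "0 \<le> \<delta>" "0 \<le> c" "c \<le> 1" "1 < q" "q < 2"
    and s: "2 - q \<le> q * c" and gap: "85 * \<delta> * c \<le> q * (q * c - (2 - q))"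
    and "0 < K" "K * m = 1" "0 \<le> W" "W \<le> 1" "0 \<le> N" "N \<le> m" "0 \<le> X" "0 \<le> Y"
  shows "2 * \<delta> * c * X * Y \<le> q * (m * ((q * c - (2 - q)) / 2) * Y\<^sup>2)
    + \<delta> * (2 * K * c * X\<^sup>2 + (2 - q) * (N * (((2 - q) * c - q) / 2) * Y\<^sup>2) - 4 * (2 - q) * W * X * Y)"
proof -
  have m: "0 \<le> m" using assms by linarith
  define E where "E = \<delta> * c"
  have E: "0 \<le> E" using assms by (simp add: E_def)
  define T1 where "T1 = q * (m * ((q * c - (2 - q)) / 2) * Y\<^sup>2)"
  define T2 where "T2 = (2 - q) * (N * (((2 - q) * c - q) / 2) * Y\<^sup>2)"
  define T3 where "T3 = 4 * (2 - q) * W * X * Y"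
  have "(85 * \<delta> * c) * (m * Y\<^sup>2 / 2) \<le> (q * (q * c - (2 - q))) * (m * Y\<^sup>2 / 2)"
    using gap m by (intro mult_right_mono) auto
  moreover have "(q * (q * c - (2 - q))) * (m * Y\<^sup>2 / 2) = T1" by (simp add: T1_def)
  moreover have "(85 * \<delta> * c) * (m * Y\<^sup>2 / 2) = 85 / 2 * (E * (m * Y\<^sup>2))" by (simp add: E_def)
  ultimately have 1: "85 / 2 * (E * (m * Y\<^sup>2)) \<le> T1" by linarith
  have "(2 - q) * c \<le> 1 * 1" using assms by (intro mult_mono) auto
  then have "((2 - q) * N) * (q - (2 - q) * c) \<le> ((q * c) * m) * q"
    using assms m by (intro mult_mono) (auto intro!: mult_nonneg_nonneg)
  also have "\<dots> = (c * m) * q\<^sup>2" by (simp add: power2_eq_square)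
  also have "\<dots> \<le> (c * m) * 2\<^sup>2"
    using assms m by (intro mult_left_mono power_mono) auto
  finally have "((2 - q) * N) * (q - (2 - q) * c) * (Y\<^sup>2 / 2) \<le> (c * m) * 2\<^sup>2 * (Y\<^sup>2 / 2)"
    by (intro mult_right_mono) auto
  moreover have "((2 - q) * N) * (q - (2 - q) * c) * (Y\<^sup>2 / 2) = - T2"
    unfolding T2_def by (simp add: field_simps)
  ultimately have "- T2 \<le> 2 * (c * (m * Y\<^sup>2))" by simp
  then have "\<delta> * - T2 \<le> \<delta> * (2 * (c * (m * Y\<^sup>2)))" using assms(1) by (rule mult_left_mono)
  then have 2: "- (\<delta> * T2) \<le> 2 * (E * (m * Y\<^sup>2))" by (simp add: E_def mult_ac)
  have "(2 - q) * W \<le> (2 * c) * 1"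
  proof (rule mult_mono)
    have "q * c \<le> 2 * c" using assms by (intro mult_right_mono) auto
    then show "2 - q \<le> 2 * c" using s by linarith
  qed (use assms in auto)
  then have "(2 - q) * W * (4 * (X * Y)) \<le> (2 * c) * 1 * (4 * (X * Y))"
    using assms by (intro mult_right_mono) auto
  then have "\<delta> * T3 \<le> \<delta> * (8 * (c * (X * Y)))"
    using assms(1) unfolding T3_def by (intro mult_left_mono) (simp_all add: mult_ac)
  then have 3: "\<delta> * T3 \<le> 8 * (E * (X * Y))" by (simp add: E_def mult_ac)
  (* The factor 5/2 turns the coefficient 2 of the weighted inequality into the 10 that is needed,
     at the price of 25/2 <= 81/2. *)
  have "2 * X * ((5/2) * Y) \<le> K * X\<^sup>2 + m * ((5/2) * Y)\<^sup>2"
    using assms by (intro weighted_square_sum_ge) auto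
  moreover have "m * ((5/2) * Y)\<^sup>2 = 25/4 * (m * Y\<^sup>2)" by (simp add: power_mult_distrib power_divide)
  moreover have "0 \<le> m * Y\<^sup>2" using m by simp
  ultimately have "10 * (X * Y) \<le> 2 * (K * X\<^sup>2) + 81 / 2 * (m * Y\<^sup>2)"
    by linarith
  from mult_left_mono[OF this E]
  have 4: "10 * (E * (X * Y)) \<le> 2 * (E * (K * X\<^sup>2)) + 81 / 2 * (E * (m * Y\<^sup>2))"
    by (simp add: ring_distribs)
  have "\<delta> * (2 * K * c * X\<^sup>2 + T2 - T3) = 2 * (E * (K * X\<^sup>2)) + \<delta> * T2 - \<delta> * T3"
    by (simp add: E_def ring_distribs)
  moreover have "2 * \<delta> * c * X * Y = 2 * (E * (X * Y))" by (simp add: E_def)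
  ultimately show ?thesis
    using 1 2 3 4 unfolding T1_def[symmetric] T2_def[symmetric] T3_def[symmetric] by linarith
qed

lemma powr_le_powr_of_powr_le:
  fixes u v :: real
  assumes "0 \<le> u" "0 \<le> v" "u powr a \<le> v powr b" "0 < a" "0 \<le> t"
  shows "u powr t \<le> v powr (b * t / a)"
proof -
  have "(u powr a) powr (t / a) \<le> (v powr b) powr (t / a)"
    using assms by (intro powr_mono2) auto
  then show ?thesis using assms(4) by (simp add: powr_powr)
qed

section \<open>The angle and the constant\<close>

lemma cos_ge_of_phi_angle:
  assumes "1 \<le> r" and "\<phi> \<in> {- phi_angle r .. phi_angle r}"
  shows "\<bar>1 - 2 / r\<bar> \<le> cos \<phi>"
proof -
  have y: "\<bar>1 - 2 / r\<bar> \<le> 1" using assms(1) by (simp add: abs_le_iff field_simps)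
  have "cos (phi_angle r) \<le> cos \<bar>\<phi>\<bar>"
    using assms(2) y unfolding phi_angle_def by (intro cos_monotone_0_pi_le arccos_ubound) auto
  then show ?thesis using y by (simp add: phi_angle_def)
qed

lemma conj_exp_facts:
  assumes "2 < p"
  shows "1 < conj_exp p" "conj_exp p < 2" "conj_exp p / p = conj_exp p - 1"
    "conj_exp p * (p - 2) / p = 2 - conj_exp p" "2 - conj_exp p = (conj_exp p - 1) * (p - 2)"
    "conj_exp p = (conj_exp p - 1) * p"
  using assms by (auto simp: conj_exp_def field_simps)

text \<open>
  Since \<open>1 - 2/p_\<epsilon> = (p - 2)/(p - 2\<epsilon>)\<close>, the bound on the angle reads \<open>(p - 2\<epsilon>) cos \<phi> \<ge> p - 2\<close>, which
  is the first gap. The second is the first multiplied by \<open>q (q - 1)\<close>, by conjugacy; the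
  factor \<open>2q(q - 1)\<epsilon>\<close> that then appears is \<open>85 \<delta>\<close>.
\<close>

lemma ellipticity_gap:
  assumes "2 < p" "0 < \<epsilon>" "\<epsilon> < 1 / 2"
    and "\<phi> \<in> {- phi_angle (p_eps p \<epsilon>) .. phi_angle (p_eps p \<epsilon>)}"
  defines "q \<equiv> conj_exp p"
  shows "0 < cos \<phi>"
    and "2 * \<epsilon> * cos \<phi> \<le> p * cos \<phi> - (p - 2)"
    and "q * cos \<phi> - (2 - q) = (q - 1) * (p * cos \<phi> - (p - 2))"
    and "85 * nt_delta p \<epsilon> * cos \<phi> \<le> q * (q * cos \<phi> - (2 - q))"
    and "0 \<le> nt_delta p \<epsilon>" and "nt_delta p \<epsilon> \<le> \<epsilon>"
proof -
  note q = conj_exp_facts[OF assms(1), folded q_def]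
  have r: "2 < p_eps p \<epsilon>" using assms(1-3) by (simp add: p_eps_def field_simps)
  have "1 - 2 / p_eps p \<epsilon> = (p - 2) / (p - 2 * \<epsilon>)"
    using assms(1-3) by (simp add: p_eps_def field_simps)
  then have c: "(p - 2) / (p - 2 * \<epsilon>) \<le> cos \<phi>"
    using cos_ge_of_phi_angle[OF _ assms(4)] r abs_ge_self[of "1 - 2 / p_eps p \<epsilon>"] by linarith
  moreover have "0 < (p - 2) / (p - 2 * \<epsilon>)" using assms(1-3) by simp
  ultimately show c0: "0 < cos \<phi>" by linarith
  show gap: "2 * \<epsilon> * cos \<phi> \<le> p * cos \<phi> - (p - 2)"
    using c assms(1-3) by (simp add: field_simps)
  show eq: "q * cos \<phi> - (2 - q) = (q - 1) * (p * cos \<phi> - (p - 2))"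
    using q(5,6) by algebra
  have d: "nt_delta p \<epsilon> = 2 * q * (q - 1) * \<epsilon> / 85"
    by (simp add: nt_delta_def q_def Let_def)
  have "q * (q - 1) * (2 * \<epsilon> * cos \<phi>) \<le> q * (q - 1) * (p * cos \<phi> - (p - 2))"
    using gap q by (intro mult_left_mono) auto
  moreover have "85 * nt_delta p \<epsilon> * cos \<phi> = q * (q - 1) * (2 * \<epsilon> * cos \<phi>)"
    unfolding d by simp
  ultimately show "85 * nt_delta p \<epsilon> * cos \<phi> \<le> q * (q * cos \<phi> - (2 - q))"
    unfolding eq by (simp only: mult.assoc)
  show "0 \<le> nt_delta p \<epsilon>" unfolding d using q assms(2) by simp
  have "q * (q - 1) \<le> 2 * 1" using q by (intro mult_mono) auto
  then have "q * (q - 1) * \<epsilon> \<le> 2 * 1 * \<epsilon>" using assms(2) by (intro mult_right_mono) auto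
  then show "nt_delta p \<epsilon> \<le> \<epsilon>" unfolding d using assms(2) by simp
qed

section \<open>The Nazarov-Treil function\<close>

lemma open_powr_norm_less:
  fixes f g :: "'a::topological_space \<Rightarrow> 'b::real_normed_vector"
  assumes "0 < a" "0 < b" "continuous_on UNIV f" "continuous_on UNIV g"
  shows "open {z. norm (f z) powr a < norm (g z) powr b}"
  using assms by (intro open_Collect_less continuous_on_powr' continuous_on_norm continuous_on_const) auto

theorem theorem15:
  fixes p \<epsilon> \<phi> :: real
    and \<xi> :: "(real^2) \<times> (real^2)"
    and \<omega>\<^sub>1 \<omega>\<^sub>2 :: "real^2"
  assumes "2 < p"
    and "0 < \<epsilon>" and "\<epsilon> < 1 / 2"
    and "\<phi> \<in> {- phi_angle (p_eps p \<epsilon>) .. phi_angle (p_eps p \<epsilon>)}"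
    and "\<xi> \<notin> Upsilon0 p"
  shows "R_form \<phi> (nazarov_treil p \<epsilon>) \<xi> (\<omega>\<^sub>1, \<omega>\<^sub>2)
           \<ge> 2 * nt_delta p \<epsilon> * cos \<phi> * norm \<omega>\<^sub>1 * norm \<omega>\<^sub>2"
proof -
  obtain \<zeta> \<eta> where \<xi>: "\<xi> = (\<zeta>, \<eta>)" by (cases \<xi>)
  define q where "q = conj_exp p"
  define \<delta> where "\<delta> = nt_delta p \<epsilon>"
  define c where "c = cos \<phi>"
  define u where "u = norm \<zeta>"
  define v where "v = norm \<eta>"
  define X where "X = norm \<omega>\<^sub>1"
  define Y where "Y = norm \<omega>\<^sub>2"
  note q = conj_exp_facts[OF assms(1), folded q_def]
  note gap = ellipticity_gap[OF assms(1-4), folded q_def \<delta>_def c_def]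
  have eta: "\<eta> \<noteq> 0" and ne: "u powr p \<noteq> v powr q"
    using assms(5) by (auto simp: \<xi> Upsilon0_def q_def u_def v_def)
  have uv: "0 \<le> u" "0 < v" and XY: "0 \<le> X" "0 \<le> Y"
    using eta by (auto simp: u_def v_def X_def Y_def)
  have ec: "0 < \<epsilon> * c" using gap(1) assms(2) by simp
  then have pgap: "0 \<le> p * c - (p - 2)" using gap(2) by linarith
  have dc: "\<delta> * c \<le> \<epsilon> * c" "0 \<le> \<delta> * c" using gap(1,5,6) by (auto intro!: mult_right_mono)
  have qgap: "0 \<le> q * c - (2 - q)" unfolding gap(3) using q(1) pgap by simp
  note model = R_form_power_model_ge[OF assms(1) q(1,2), of "2 - q" _ _ _ \<eta>]
  have "2 * \<delta> * c * X * Y \<le> R_form \<phi> (nazarov_treil p \<epsilon>) (\<zeta>, \<eta>) (\<omega>\<^sub>1, \<omega>\<^sub>2)"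
  proof (cases "u powr p < v powr q")
    case True
    define S where "S = {z :: (real^2) \<times> (real^2). norm (fst z) powr p < norm (snd z) powr q}"
    have S: "open S" "(\<zeta>, \<eta>) \<in> S"
      using True assms(1) q(1) unfolding S_def u_def v_def
      by (auto intro!: open_powr_norm_less continuous_intros)
    have Q: "nazarov_treil p \<epsilon> z = 1 * norm (fst z) powr p + 1 * norm (snd z) powr q
          + \<delta> * ((norm (fst z))\<^sup>2 * norm (snd z) powr (2 - q))" if "z \<in> S" for z
      using that by (simp add: nazarov_treil_def S_def Let_def q_def \<delta>_def case_prod_beta)
    have "2 * \<delta> * c * X * Y
      \<le> q * (v powr (q - 2) * ((q * c - (2 - q)) / 2) * Y\<^sup>2)
        + \<delta> * (2 * v powr (2 - q) * c * X\<^sup>2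
             + (2 - q) * ((u\<^sup>2 * v powr - q) * (((2 - q) * c - q) / 2) * Y\<^sup>2)
             - 4 * (2 - q) * (u * v powr (1 - q)) * X * Y)"
    proof (rule subcritical_form_ge)
      have u: "u powr t \<le> v powr ((q - 1) * t)" if "0 \<le> t" for t
        using powr_le_powr_of_powr_le[of u v p q t] True uv assms(1) that
        by (simp add: q(3)[symmetric])
      have "u * v powr (1 - q) \<le> v powr (q - 1) * v powr (1 - q)"
        using u[of 1] uv by (intro mult_right_mono) auto
      also have "\<dots> = 1" using uv by (simp flip: powr_add)
      finally show "u * v powr (1 - q) \<le> 1" .
      have "u\<^sup>2 * v powr - q \<le> v powr ((q - 1) * 2) * v powr - q"
        using u[of 2] uv by (intro mult_right_mono) auto
      also have "\<dots> = v powr (q - 2)" by (simp flip: powr_add)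
      finally show "u\<^sup>2 * v powr - q \<le> v powr (q - 2)" .
      show "v powr (2 - q) * v powr (q - 2) = 1" using uv by (simp flip: powr_add)
    qed (use gap q qgap uv XY in \<open>auto simp: c_def\<close>)
    \<comment> \<open>Near \<open>\<zeta> = 0\<close> the pure power of \<open>|\<zeta>|\<close> degenerates, so the mixed term has to control
      \<open>\<omega>\<^sub>1\<close>, and of the pure power only the sign is used.\<close>
    moreover have "0 \<le> p * (u powr (p - 2) * ((p * c - (p - 2)) / 2) * X\<^sup>2)"
      using pgap assms(1) by simp
    moreover have "R_form \<phi> (nazarov_treil p \<epsilon>) (\<zeta>, \<eta>) (\<omega>\<^sub>1, \<omega>\<^sub>2)
      \<ge> 1 * p * (u powr (p - 2) * ((p * c - (p - 2)) / 2) * X\<^sup>2)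
        + 1 * q * (v powr (q - 2) * ((q * c - (2 - q)) / 2) * Y\<^sup>2)
        + \<delta> * (2 * v powr (2 - q) * c * X\<^sup>2
             + (2 - q) * u\<^sup>2 * (v powr - q * (((2 - q) * c - q) / 2) * Y\<^sup>2)
             - 4 * (2 - q) * u * v powr (1 - q) * X * Y)"
    proof -
      have e: "2 - q - 2 = - q" "2 - q - 1 = 1 - q" "2 - (2 - q) = q" by simp_all
      have nz: "snd z \<noteq> 0" if "z \<in> S" for z
        using that powr_ge_zero[of "norm (fst z)" p] by (auto simp: S_def)
      show ?thesis
        unfolding c_def u_def v_def X_def Y_def
        by (rule model[OF _ _ _ _ gap(5) eta S nz Q, of \<phi> \<omega>\<^sub>1 \<omega>\<^sub>2, unfolded e]) (use q in simp_all)
    qed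
    ultimately show ?thesis by (simp only: mult.assoc mult_1)
  next    case False
    then have less: "v powr q < u powr p" using ne by simp
    then have u: "0 < u" using uv(1) by (cases "u = 0") auto
    define A where "A = 1 + \<delta> * (2 / p)"
    define B where "B = 1 + \<delta> * (2 / q - 1)"
    have "0 \<le> 2 / p" "0 \<le> 2 / q - 1" using assms(1) q(1,2) by auto
    then have AB: "1 \<le> A" "1 \<le> B" using gap(5) by (simp_all add: A_def B_def)
    define S where "S = {z :: (real^2) \<times> (real^2). norm (snd z) powr q < norm (fst z) powr p} \<inter> {z. snd z \<noteq> 0}"
    have S: "open S" "(\<zeta>, \<eta>) \<in> S"
      using assms(1) q(1) less eta unfolding S_def u_def v_def
      by (auto intro!: open_Int open_powr_norm_less open_Collect_neq continuous_intros)
    have nz: "snd z \<noteq> 0" if "z \<in> S" for z using that by (simp add: S_def)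
    have Q: "nazarov_treil p \<epsilon> z = A * norm (fst z) powr p + B * norm (snd z) powr q
          + 0 * ((norm (fst z))\<^sup>2 * norm (snd z) powr (2 - q))" if "z \<in> S" for z
      using that by (simp add: nazarov_treil_def S_def Let_def q_def \<delta>_def case_prod_beta A_def B_def algebra_simps)
    have R: "R_form \<phi> (nazarov_treil p \<epsilon>) (\<zeta>, \<eta>) (\<omega>\<^sub>1, \<omega>\<^sub>2)
       \<ge> A * p * (u powr (p - 2) * ((p * c - (p - 2)) / 2) * X\<^sup>2)
        + B * q * (v powr (q - 2) * ((q * c - (2 - q)) / 2) * Y\<^sup>2)"
      unfolding c_def u_def v_def X_def Y_def
      by (rule model[OF _ _ _ _ order_refl eta S nz Q, of \<phi> \<omega>\<^sub>1 \<omega>\<^sub>2, unfolded mult_zero_left add_0_right])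
        (use q AB in simp_all)
    \<comment> \<open>Both gaps are at least \<open>2 \<delta> c\<close> already, so the factors \<open>A * p\<close> and \<open>B\<close> may be replaced
      by \<open>1\<close>.\<close>
    have "1 * (2 * \<epsilon> * c) \<le> A * p * (p * c - (p - 2))"
    proof (rule mult_mono)
      show "1 \<le> A * p" using mult_mono[OF AB(1), of 1 p] assms(1) AB by simp
    qed (use gap(2) ec AB assms(1) in auto)
    then have U: "\<delta> * c * (u powr (p - 2) * X\<^sup>2) \<le> A * p * (p * c - (p - 2)) / 2 * (u powr (p - 2) * X\<^sup>2)"
      using dc by (intro mult_right_mono) auto
    have "1 * (85 * \<delta> * c) \<le> B * (q * (q * c - (2 - q)))"
      by (rule mult_mono) (use gap(4) dc AB in auto)
    then have V: "\<delta> * c * (v powr (q - 2) * Y\<^sup>2) \<le> B * (q * (q * c - (2 - q))) / 2 * (v powr (q - 2) * Y\<^sup>2)"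
      using dc by (intro mult_right_mono) auto
    have "2 * X * Y \<le> u powr (p - 2) * X\<^sup>2 + v powr (q - 2) * Y\<^sup>2"
    proof (rule weighted_square_sum_ge)
      have "v powr (2 - q) = (v powr q) powr ((p - 2) / p)" by (simp add: powr_powr q(4))
      also have "\<dots> \<le> (u powr p) powr ((p - 2) / p)"
        using less assms(1) by (intro powr_mono2) auto
      also have "\<dots> = u powr (p - 2)" using assms(1) by (simp add: powr_powr)
      finally have "v powr (2 - q) * v powr (q - 2) \<le> u powr (p - 2) * v powr (q - 2)"
        by (intro mult_right_mono) auto
      then show "1 \<le> u powr (p - 2) * v powr (q - 2)" using uv by (simp flip: powr_add)
    qed (use u in simp)
    then have "\<delta> * c * (2 * X * Y) \<le> \<delta> * c * (u powr (p - 2) * X\<^sup>2 + v powr (q - 2) * Y\<^sup>2)"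
      using dc(2) by (rule mult_left_mono)
    moreover have "A * p * (p * c - (p - 2)) / 2 * (u powr (p - 2) * X\<^sup>2)
        = A * p * (u powr (p - 2) * ((p * c - (p - 2)) / 2) * X\<^sup>2)" by simp
    moreover have "B * (q * (q * c - (2 - q))) / 2 * (v powr (q - 2) * Y\<^sup>2)
        = B * q * (v powr (q - 2) * ((q * c - (2 - q)) / 2) * Y\<^sup>2)" by simp
    moreover have "2 * \<delta> * c * X * Y = \<delta> * c * (2 * X * Y)" by simp
    ultimately show ?thesis using R U V unfolding distrib_left by linarith
  qed
  then show ?thesis by (simp add: \<xi> \<delta>_def c_def X_def Y_def)
qed

end
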